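(* Let $\alpha\in(0,1)$, let $k\ge 1$ be an integer, and let $\mathcal{F}$ be a class of probability measures on $\mathbb{N}_0$ that contains all unimodal distributions with mode $k$. Then the shortest interval functional $\mathrm{SI}_\alpha$ is not elicitable relative to $\mathcal{F}$.
   Context: Here $\mathbb{N}_0=\{0,1,2,\dots\}$ and the action domain is $\mathsf{A}=\{[a,b] : a,b\in\mathbb{N}_0,\ a\le b\}$. Probability distributions are identified with their CDFs, and $F(a-)=\lim_{y\uparrow a}F(y)$. A distribution on $\mathbb{N}_0$ is unimodal with mode $k$ if its probability mass function is non-decreasing on $\{0,\dots,k\}$ and non-increasing on $\{k,k+1,\dots\}$. The shortest interval functional $\mathrm{SI}_\alpha:\mathcal{F}\to 2^{\mathsf{A}}$ is \[ \mathrm{SI}_\alpha(F)=\arg\min_{[a,b]\in\mathsf{A}}\{\,b-a : F(b)-F(a-)\ge 1-\alpha\,\}. \] A scoring function is a map $S:\mathsf{A}\times\mathbb{N}_0\to\mathbb{R}$ such that for all $x\in\mathsf{A}$ and $F\in\mathcal{F}$ the expectation $\mathbb{E}_F S(x,Y)$ (with $Y\sim F$) is well-defined and finite. For a functional $T:\mathcal{F}\to 2^{\mathsf{A}}$, $S$ is strictly consistent relative to $\mathcal{F}$ if $\mathbb{E}_F S(t,Y)\le\mathbb{E}_F S(x,Y)$ for all $F\in\mathcal{F}$, $t\in T(F)$, $x\in\mathsf{A}$, with equality only if $x\in T(F)$. $T$ is elicitable relative to $\mathcal{F}$ if there exists a scoring function that is strictly consistent for $T$ relative to $\mathcal{F}$.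 *)

theory Defs
  imports "HOL-Probability.Probability"
begin

text \<open>
  Probability measures on the non-negative integers are represented by \<^typ>\<open>nat pmf\<close>,
  and an interval \<open>[a,b]\<close> by the pair \<open>(a,b)\<close> of its endpoints.
\<close>

definition action_domain :: "(nat \<times> nat) set" where
  "action_domain = {(a, b). a \<le> b}"

definition dist_cdf :: "nat pmf \<Rightarrow> real \<Rightarrow> real" where
  "dist_cdf F = cdf (distr (measure_pmf F) borel real)"

definition cdf_left_limit :: "nat pmf \<Rightarrow> real \<Rightarrow> real" where
  "cdf_left_limit F a = Lim (at_left a) (dist_cdf F)"

definition shortest_interval :: "real \<Rightarrow> nat pmf \<Rightarrow> (nat \<times> nat) set" where
  "shortest_interval \<alpha> F =
    {x. is_arg_min (\<lambda>(a, b). int b - int a)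
          (\<lambda>(a, b). (a, b) \<in> action_domain \<and>
             dist_cdf F (real b) - cdf_left_limit F (real a) \<ge> 1 - \<alpha>) x}"

definition unimodal_with_mode :: "nat \<Rightarrow> nat pmf \<Rightarrow> bool" where
  "unimodal_with_mode k F \<longleftrightarrow> mono_on {0..k} (pmf F) \<and> antimono_on {k..} (pmf F)"

text \<open>
  Scoring functions and functionals are total functions here, but only the values of a score at
  actions in \<^const>\<open>action_domain\<close> and of a functional at distributions in \<open>\<F>\<close> are used.
\<close>

definition scoring_function :: "nat pmf set \<Rightarrow> (nat \<times> nat \<Rightarrow> nat \<Rightarrow> real) \<Rightarrow> bool" where
  "scoring_function \<F> S \<longleftrightarrow>
    (\<forall>x\<in>action_domain. \<forall>F\<in>\<F>. integrable (measure_pmf F) (S x))"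

definition strictly_consistent ::
  "nat pmf set \<Rightarrow> (nat pmf \<Rightarrow> (nat \<times> nat) set) \<Rightarrow> (nat \<times> nat \<Rightarrow> nat \<Rightarrow> real) \<Rightarrow> bool" where
  "strictly_consistent \<F> T S \<longleftrightarrow>
    (\<forall>F\<in>\<F>. \<forall>t\<in>T F. \<forall>x\<in>action_domain.
       measure_pmf.expectation F (S t) \<le> measure_pmf.expectation F (S x) \<and>
       (measure_pmf.expectation F (S t) = measure_pmf.expectation F (S x) \<longrightarrow> x \<in> T F))"

definition elicitable :: "nat pmf set \<Rightarrow> (nat pmf \<Rightarrow> (nat \<times> nat) set) \<Rightarrow> bool" where
  "elicitable \<F> T \<longleftrightarrow> (\<exists>S. scoring_function \<F> S \<and> strictly_consistent \<F> T S)"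

end

theory Submission
  imports Defs
begin

text \<open>
  If two actions \<open>s\<close>, \<open>t\<close> are both optimal under \<open>F\<close> and only \<open>t\<close> is optimal under \<open>G\<close>, then a
  strictly consistent score makes \<open>s\<close> strictly worse than \<open>t\<close> under every mixture that involves
  \<open>G\<close>. For shortest intervals of \<open>n + 1\<close> points this fails: choose \<open>F\<close> so that \<open>[0,n]\<close> and
  \<open>[1,n+1]\<close> have coverage strictly above \<open>1 - \<alpha>\<close>, and \<open>G\<close> so that \<open>[0,n]\<close> has coverage exactly
  \<open>1 - \<alpha>\<close> and \<open>[1,n+1]\<close> slightly less. A suitable mixture gives \<open>[1,n+1]\<close> coverage \<open>1 - \<alpha>\<close>
  again. For large \<open>n\<close> both \<open>F\<close> and \<open>G\<close> can be constant on \<open>{0..k}\<close> and non-increasing.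
\<close>

definition mixture_pmf :: "real \<Rightarrow> 'a pmf \<Rightarrow> 'a pmf \<Rightarrow> 'a pmf" where
  "mixture_pmf p F G = bind_pmf (bernoulli_pmf p) (\<lambda>b. if b then F else G)"

lemma pmf_mixture_pmf:
  assumes "0 \<le> p" "p \<le> 1"
  shows "pmf (mixture_pmf p F G) x = p * pmf F x + (1 - p) * pmf G x"
  using assms by (simp add: mixture_pmf_def pmf_bind)

lemma prob_mixture_pmf:
  assumes "0 \<le> p" "p \<le> 1" "finite A"
  shows "measure_pmf.prob (mixture_pmf p F G) A =
    p * measure_pmf.prob F A + (1 - p) * measure_pmf.prob G A"
  using assms
  by (simp add: measure_measure_pmf_finite pmf_mixture_pmf sum.distrib sum_distrib_left)

lemma expectation_mixture_pmf:
  fixes f :: "'a \<Rightarrow> real"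
  assumes p: "0 \<le> p" "p \<le> 1"
    and int: "integrable (measure_pmf F) f" "integrable (measure_pmf G) f"
  shows "measure_pmf.expectation (mixture_pmf p F G) f =
    p * measure_pmf.expectation F f + (1 - p) * measure_pmf.expectation G f"
proof -
  \<comment> \<open>Against the counting measure the mass function is a factor of the integrand, so
    linearity in the distribution becomes linearity of the integral.\<close>
  have E: "measure_pmf.expectation H f = (\<integral>x. pmf H x * f x \<partial>count_space UNIV)" for H
    by (simp add: measure_pmf_eq_density integral_density)
  have I: "integrable (count_space UNIV) (\<lambda>x. pmf H x * f x)" if "integrable (measure_pmf H) f" for H
    using that by (simp add: measure_pmf_eq_density integrable_density)
  have "(\<integral>x. pmf (mixture_pmf p F G) x * f x \<partial>count_space UNIV) =
      (\<integral>x. p * (pmf F x * f x) + (1 - p) * (pmf G x * f x) \<partial>count_space UNIV)"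
    using p by (simp add: pmf_mixture_pmf algebra_simps)
  also have "\<dots> = p * (\<integral>x. pmf F x * f x \<partial>count_space UNIV) +
      (1 - p) * (\<integral>x. pmf G x * f x \<partial>count_space UNIV)"
    using I[OF int(1)] I[OF int(2)] by simp
  finally show ?thesis by (simp add: E)
qed

lemma unimodal_mixture_pmf:
  assumes "0 \<le> p" "p \<le> 1" "unimodal_with_mode k F" "unimodal_with_mode k G"
  shows "unimodal_with_mode k (mixture_pmf p F G)"
  using assms unfolding unimodal_with_mode_def monotone_on_def
  by (auto simp: pmf_mixture_pmf intro!: add_mono mult_left_mono)

lemma not_elicitable_if_mixture:
  assumes \<F>: "F \<in> \<F>" "G \<in> \<F>" "mixture_pmf p F G \<in> \<F>"
    and p: "0 \<le> p" "p < 1"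
    and dom: "s \<in> action_domain" "t \<in> action_domain"
    and F: "s \<in> T F" "t \<in> T F"
    and G: "s \<notin> T G" "t \<in> T G"
    and mix: "s \<in> T (mixture_pmf p F G)"
  shows "\<not> elicitable \<F> T"
proof
  let ?E = measure_pmf.expectation
  assume "elicitable \<F> T"
  then obtain S where S: "scoring_function \<F> S" "strictly_consistent \<F> T S"
    unfolding elicitable_def by blast
  have opt: "?E H (S x) \<le> ?E H (S y)" "?E H (S x) = ?E H (S y) \<Longrightarrow> y \<in> T H"
    if "H \<in> \<F>" "x \<in> T H" "y \<in> action_domain" for H x y
    using S(2) that unfolding strictly_consistent_def by blast+
  have E: "?E (mixture_pmf p F G) (S x) = p * ?E F (S x) + (1 - p) * ?E G (S x)"
    if "x \<in> action_domain" for x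
    using S(1) \<F> p that by (intro expectation_mixture_pmf) (auto simp: scoring_function_def)
  have "?E F (S s) = ?E F (S t)"
    using opt(1) \<F>(1) F dom by (meson order_antisym)
  moreover have "?E G (S t) < ?E G (S s)"
    using opt[OF \<F>(2) G(2) dom(1)] G(1) by force
  \<comment> \<open>Here \<open>p < 1\<close> matters: \<open>G\<close> keeps positive weight, so
    its strict gap survives in the mixture.\<close>
  then have "(1 - p) * ?E G (S t) < (1 - p) * ?E G (S s)"
    using p by simp
  ultimately show False
    using opt(1)[OF \<F>(3) mix dom(2)] E[OF dom(1)] E[OF dom(2)] by simp
qed

text \<open>The left limit of the CDF at \<open>a\<close> is the mass strictly below
  \<open>a\<close>, so the difference keeps the atom at \<open>a\<close>. From here on coverage is a
  finite sum of point masses.\<close>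

lemma coverage_eq_prob:
  assumes "a \<le> b"
  shows "dist_cdf F (real b) - cdf_left_limit F (real a) = measure_pmf.prob F {a..b}"
proof -
  interpret D: real_distribution "distr (measure_pmf F) borel real"
    by (rule real_distribution.intro, rule measure_pmf.prob_space_distr)
       (auto intro!: real_distribution_axioms.intro)
  have "(dist_cdf F \<longlongrightarrow> measure (distr (measure_pmf F) borel real) {..<real a}) (at_left (real a))"
    unfolding dist_cdf_def by (rule D.cdf_at_left)
  moreover have "measure (distr (measure_pmf F) borel real) {..<real a} = measure_pmf.prob F {..<a}"
    by (subst measure_distr) (auto intro!: arg_cong[where f = "measure_pmf.prob F"])
  ultimately have left: "cdf_left_limit F (real a) = measure_pmf.prob F {..<a}"
    unfolding cdf_left_limit_def by (intro tendsto_Lim) simp_all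
  have right: "dist_cdf F (real b) = measure_pmf.prob F {..b}"
    unfolding dist_cdf_def cdf_def
    by (subst measure_distr) (auto intro!: arg_cong[where f = "measure_pmf.prob F"])
  have "measure_pmf.prob F {..b} - measure_pmf.prob F {..<a} = measure_pmf.prob F ({..b} - {..<a})"
    using assms by (intro measure_pmf.finite_measure_Diff[symmetric]) auto
  also have "{..b} - {..<a} = {a..b}"
    by auto
  finally show ?thesis
    by (simp add: left right)
qed

lemma prob_interval_le:
  assumes "\<And>i. pmf F i \<le> c"
  shows "measure_pmf.prob F {a..<a + n} \<le> real n * c"
  using sum_mono[of "{a..<a + n}" "pmf F" "\<lambda>_. c"] assms
  by (simp add: measure_measure_pmf_finite)

text \<open>With point masses at most \<open>c\<close>, any \<open>n\<close> consecutive points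
  carry at most \<open>n * c\<close>, which is below the required level. So no interval with fewer
  than \<open>n + 1\<close> points competes, and minimality of length is automatic.\<close>

lemma shortest_interval_iff:
  assumes le: "\<And>i. pmf F i \<le> c" and c: "real n * c < 1 - \<alpha>"
  shows "(a, a + n) \<in> shortest_interval \<alpha> F \<longleftrightarrow> measure_pmf.prob F {a..a + n} \<ge> 1 - \<alpha>"
proof -
  have long: "a' + n \<le> b" if "a' \<le> b" "measure_pmf.prob F {a'..b} \<ge> 1 - \<alpha>" for a' b
  proof (rule ccontr)
    assume "\<not> a' + n \<le> b"
    then have "measure_pmf.prob F {a'..b} \<le> measure_pmf.prob F {a'..<a' + n}"
      by (intro measure_pmf.finite_measure_mono) auto
    with prob_interval_le[OF le] that c show False
      by (meson order.trans not_le)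
  qed
  have "(a, a + n) \<in> shortest_interval \<alpha> F \<longleftrightarrow>
      1 - \<alpha> \<le> dist_cdf F (real (a + n)) - cdf_left_limit F (real a) \<and>
      (\<forall>a' b. a' \<le> b \<and> 1 - \<alpha> \<le> dist_cdf F (real b) - cdf_left_limit F (real a') \<longrightarrow>
        \<not> int b - int a' < int (a + n) - int a)"
    unfolding shortest_interval_def is_arg_min_def action_domain_def by auto
  also have "\<dots> \<longleftrightarrow> measure_pmf.prob F {a..a + n} \<ge> 1 - \<alpha> \<and>
      (\<forall>a' b. a' \<le> b \<and> measure_pmf.prob F {a'..b} \<ge> 1 - \<alpha> \<longrightarrow>
        \<not> int b - int a' < int (a + n) - int a)"
    using coverage_eq_prob[of a "a + n" F] by (simp only: coverage_eq_prob le_add1 cong: conj_cong)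
  also have "\<dots> \<longleftrightarrow> measure_pmf.prob F {a..a + n} \<ge> 1 - \<alpha>"
    using long by force
  finally show ?thesis .
qed

text \<open>Put mass \<open>w\<close> evenly on the first \<open>m\<close> points and spread the
  remaining \<open>1 - w\<close> evenly over \<open>M\<close> further points. A large
  \<open>M\<close> pushes the second step below \<epsilon>, hence below the first.\<close>

lemma obtain_step_pmf:
  assumes m: "m > 0" and w: "0 \<le> w" "w \<le> 1" and \<epsilon>: "0 < \<epsilon>" "\<epsilon> \<le> w / real m"
  obtains F :: "nat pmf" where "\<And>i. i < m \<Longrightarrow> pmf F i = w / real m"
    and "\<And>i. i \<ge> m \<Longrightarrow> pmf F i \<le> \<epsilon>" and "antimono (pmf F)"
proof -
  obtain M :: nat where M: "M > 0" "(1 - w) / real M \<le> \<epsilon>"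
  proof -
    obtain M :: nat where "real M > (1 - w) / \<epsilon>" using reals_Archimedean2 by blast
    moreover have "(1 - w) / \<epsilon> \<ge> 0" using w \<epsilon> by simp
    ultimately have "M > 0" "1 - w \<le> \<epsilon> * real M"
      using \<epsilon> by (auto simp: field_simps intro: gr0I)
    then show thesis by (intro that[of M]) (auto simp: field_simps)
  qed
  define F where "F = mixture_pmf w (pmf_of_set {..<m}) (pmf_of_set {m..<m + M})"
  have pmf: "pmf F i = (if i < m then w / real m else if i < m + M then (1 - w) / real M else 0)" for i
    using m M w unfolding F_def
    by (subst pmf_mixture_pmf) (auto simp: indicator_def lessThan_empty_iff)
  show thesis
  proof (rule that[of F])
    show "pmf F i = w / real m" if "i < m" for i
      using that by (simp add: pmf)
    show "pmf F i \<le> \<epsilon>" if "i \<ge> m" for i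
      using that M \<epsilon> by (simp add: pmf)
    have "(1 - w) / real M \<le> w / real m" "0 \<le> w / real m" "0 \<le> (1 - w) / real M"
      using M \<epsilon> w by auto
    then show "antimono (pmf F)"
      by (intro antimonoI) (auto simp: pmf)
  qed
qed

lemma unimodal_if_antimono:
  assumes "antimono (pmf F)" and "\<And>i. i \<le> k \<Longrightarrow> pmf F i = c"
  shows "unimodal_with_mode k F"
  using assms unfolding unimodal_with_mode_def monotone_on_def by auto

theorem theorem3p5:
  fixes \<alpha> :: real and k :: nat and \<F> :: "nat pmf set"
  assumes "0 < \<alpha>" and "\<alpha> < 1"
    and "k \<ge> 1"
    and "{F. unimodal_with_mode k F} \<subseteq> \<F>"
  shows "\<not> elicitable \<F> (shortest_interval \<alpha>)"
proof -
  define q where "q = 1 - \<alpha>"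
  have q: "0 < q" "q < 1" using assms by (auto simp: q_def)
  \<comment> \<open>The bound 2 / \<alpha> leaves room for \<open>n + 2\<close> points of mass
    \<open>c\<close> below; \<open>n \<ge> k\<close> makes both distributions flat on
    \<open>{0..k}\<close>.\<close>
  obtain N :: nat where N: "real N > 2 / \<alpha>" using reals_Archimedean2 by blast
  define n where "n = max N k"
  have "real n > 2 / \<alpha>" and nk: "k \<le> n" using N by (auto simp: n_def)
  then have n\<alpha>: "real n * (1 - q) > 2" using assms by (simp add: q_def field_simps)

  \<comment> \<open>The denominator lies strictly between \<open>n\<close> and \<open>n + 1\<close>:
    \<open>n\<close> points of mass \<open>c\<close> miss the level \<open>q\<close>, and
    \<open>n + 1\<close> points exceed it. The first step of \<open>F\<close> has
    \<open>n + 2\<close> points in order to contain both intervals.\<close>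
  define c where "c = q / (real n + 1/2)"
  have c: "c > 0" "real n * c < q" "q < real (Suc n) * c" "real (n + 2) * c \<le> 1"
    using q n\<alpha> by (auto simp: c_def field_simps)
  have "real (n + 2) * c / real (n + 2) = c" by (simp del: of_nat_add)
  with c obtain F where F: "\<And>i. i < n + 2 \<Longrightarrow> pmf F i = c" "\<And>i. i \<ge> n + 2 \<Longrightarrow> pmf F i \<le> c"
    "antimono (pmf F)"
    using obtain_step_pmf[of "n + 2" "real (n + 2) * c" c]
    by (simp del: of_nat_add) blast
  \<comment> \<open>Now \<open>n + 1\<close> points reach \<open>q\<close> exactly. Halving the
    height from \<open>Suc n\<close> on makes the shifted interval lose at least
    \<open>d / 2\<close>.\<close>
  define d where "d = q / real (Suc n)"
  have d: "d > 0" "real n * d < q" "real (Suc n) * d = q"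
    using q by (auto simp: d_def field_simps)
  obtain G where G: "\<And>i. i < Suc n \<Longrightarrow> pmf G i = d" "\<And>i. i \<ge> Suc n \<Longrightarrow> pmf G i \<le> d / 2"
    "antimono (pmf G)"
    using obtain_step_pmf[of "Suc n" q "d / 2", folded d_def] q d by auto

  have le: "pmf F i \<le> c" "pmf G i \<le> d" for i
    using F(1,2)[of i] G(1,2)[of i] d by (cases "i < n + 2"; cases "i < Suc n"; linarith)+
  have sets: "{1..1 + n} = insert (Suc n) {1..n}" by auto
  have PF: "measure_pmf.prob F {0..0 + n} = real (Suc n) * c"
    "measure_pmf.prob F {1..1 + n} = real (Suc n) * c"
    using F(1) by (simp_all add: measure_measure_pmf_finite)
  have PG: "measure_pmf.prob G {0..0 + n} = q"
    using G(1) d by (simp add: measure_measure_pmf_finite)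
  have "measure_pmf.prob G {1..1 + n} = pmf G (Suc n) + real n * d"
    unfolding sets using G(1) by (simp add: measure_measure_pmf_finite)
  then have PG': "measure_pmf.prob G {1..1 + n} < q"
    using G(2)[of "Suc n"] d by (simp add: algebra_simps)

  define A where "A = measure_pmf.prob F {1..1 + n}"
  define B where "B = measure_pmf.prob G {1..1 + n}"
  have AB: "B < q" "q < A" using PG' PF c by (auto simp: A_def B_def)
  \<comment> \<open>The weight solving \<open>p * A + (1 - p) * B = q\<close>; it is below 1 because
    \<open>A\<close> exceeds \<open>q\<close>.\<close>
  define p where "p = (q - B) / (A - B)"
  have p: "0 \<le> p" "p < 1" using AB by (auto simp: p_def field_simps)
  have "p * (A - B) = q - B" using AB by (simp add: p_def)
  then have "p * A + (1 - p) * B = q" by (simp add: algebra_simps)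
  then have PH: "measure_pmf.prob (mixture_pmf p F G) {1..1 + n} = q"
    using p by (simp add: prob_mixture_pmf A_def B_def)

  have uF: "unimodal_with_mode k F" and uG: "unimodal_with_mode k G"
    using F G nk by (auto intro!: unimodal_if_antimono)
  have leH: "pmf (mixture_pmf p F G) i \<le> p * c + (1 - p) * d" for i
    using p le[of i] by (simp add: pmf_mixture_pmf add_mono mult_left_mono)
  \<comment> \<open>Intervals of \<open>n\<close> points stay short of \<open>q\<close> under the
    mixture too; strictness comes from the \<open>G\<close> term, whose weight is positive.\<close>
  have "p * (real n * c) + (1 - p) * (real n * d) < p * q + (1 - p) * q"
    using p c d by (intro add_le_less_mono mult_left_mono mult_strict_left_mono) auto
  then have cH: "real n * (p * c + (1 - p) * d) < 1 - \<alpha>"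
    by (simp add: algebra_simps q_def)
  have cF: "real n * c < 1 - \<alpha>" and cG: "real n * d < 1 - \<alpha>"
    using c d by (auto simp: q_def)
  show ?thesis
  proof (rule not_elicitable_if_mixture[where F = F and G = G and p = p
        and s = "(1, 1 + n)" and t = "(0, 0 + n)"])
    show "F \<in> \<F>" "G \<in> \<F>" "mixture_pmf p F G \<in> \<F>"
      using assms uF uG unimodal_mixture_pmf[OF _ _ uF uG, of p] p by auto
    show "(1, 1 + n) \<in> shortest_interval \<alpha> F" "(0, 0 + n) \<in> shortest_interval \<alpha> F"
      unfolding shortest_interval_iff[OF le(1) cF] PF using c by (simp_all add: q_def)
    show "(1, 1 + n) \<notin> shortest_interval \<alpha> G" "(0, 0 + n) \<in> shortest_interval \<alpha> G"
      unfolding shortest_interval_iff[OF le(2) cG] PG using PG' by (simp_all add: q_def)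
    show "(1, 1 + n) \<in> shortest_interval \<alpha> (mixture_pmf p F G)"
      unfolding shortest_interval_iff[OF leH cH] PH by (simp add: q_def)
  qed (use p in \<open>auto simp: action_domain_def\<close>)
qed

end
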